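(* Consider the changepoint double array described in the context. Suppose (post-change separation) that $F_{P_0}$ and $H$ are continuous, $H(0)=0$, and $\sup_{t\in[0,1]}|H(t)-t|>0$. Suppose also (local KL support) that $H\ll U$ with $h:=dH/dU$ and $D_{\mathrm{KL}}(H\|U)=\int_0^1\log h\,dH\in(0,\infty)$, that $\phi:=\log h$ is bounded and Lipschitz, and that there are constants $a,c\ge0$ such that for every $r\ge1$ and all $z_1,\dots,z_r\in[0,1]$, $$\log\int_\Theta\prod_{i=1}^rf_\theta(z_i)\,d\Pi(\theta)\ge\sum_{i=1}^r\log h(z_i)-a\log r-c.$$ Suppose finally that $\mathcal B_{n,w}(b_n)\to\infty$ and $\mathcal B_{n,w}(b_n)=o(T_n)$. Let $L_\phi$ be the Lipschitz constant of $\phi=\log h$ and let $K_\phi:=\sup_{u\in[0,1]}\phi(u)-\inf_{u\in[0,1]}\phi(u)$. For any $s>0$, $x>0$ and integer $r\ge1$, if $$rD_{\mathrm{KL}}(H\|U)-x-L_\phi r\Big(s+\frac{2r+1}{T_n}\Big)-a\log r-c\ \ge\ \mathcal B_{n,w}(b_n),$$ then $$\mathbb P_{P_0,T_n,P_1}\{\tau_{n,S,w}(b_n)>T_n+r\}\le\exp\Big\{-\frac{2x^2}{rK_\phi^2}\Big\}+2e^{-2T_ns^2},$$ and the same bound holds for $\tau_{n,Z,w}(b_n)$. Consequently, for $\delta\in(0,1)$, with probability at least $1-\delta$ both stopping times are at most $T_n+r$ whenever $$rD_{\mathrm{KL}}(H\|U)-a\log r-c-K_\phi\sqrt{\frac{r\log(2/\delta)}{2}}-L_\phi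 r\Big\{\sqrt{\frac{\log(4/\delta)}{2T_n}}+\frac{2r+1}{T_n}\Big\}\ \ge\ \mathcal B_{n,w}(b_n).$$
   Context: Data: $(T_n)_{n\ge1}$ is an increasing sequence of positive integers with $T_n\to\infty$; $P_0,P_1$ are probability measures on $\mathbb R$. For each $n$, the row $(X_{n,j})_{j\ge1}$ satisfies $X_{n,1},\dots,X_{n,T_n}\stackrel{iid}{\sim}P_0$, $X_{n,T_n+1},X_{n,T_n+2},\dots\stackrel{iid}{\sim}P_1$, the two blocks being independent; randomizers $\lambda_{n,j}\stackrel{iid}{\sim}U(0,1)$ are independent of the array. $\mathbb P_{P_0,T_n,P_1}$ is the law of row $n$ together with its randomizers. Conformal p-values: $p_{n,j}:=\frac1j\big(\sum_{i=1}^j\mathbf 1\{X_{n,i}<X_{n,j}\}+\lambda_{n,j}\sum_{i=1}^j\mathbf 1\{X_{n,i}=X_{n,j}\}\big)$. Detectors: $\mathcal F=\{f_\theta:\theta\in\Theta\}$ is a jointly measurable family of probability densities on $[0,1]$, $\Pi$ a probability measure on $\Theta$, $w=(w_k)_{k\ge1}$ a deterministic nonnegative weight sequence, $b_n>0$ deterministic thresholds. For $k\le t$, $M_{n,k,t}:=\int_\Theta\prod_{j=k}^t f_\theta(p_{n,j})\,d\Pi(\theta)$, $S_{n,t}^{(w)}:=\sum_{k=1}^tw_kM_{n,k,t}$, $Z_{n,t}^{(w)}:=\max_{1\le k\le t}w_kM_{n,k,t}$, $\tau_{n,S,w}(b):=\inf\{t\ge1:S_{n,t}^{(w)}\ge b\}$,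 $\tau_{n,Z,w}(b):=\inf\{t\ge1:Z_{n,t}^{(w)}\ge b\}$ ($\inf\varnothing=\infty$). $\mathcal B_{n,w}(b_n):=\log\frac{b_n}{w_{T_n+1}}$ (with $\log(b/0)=+\infty$). $F_{P_0}$ is the CDF of $P_0$ and $H(t):=\mathbb P_{Y\sim P_1}\{F_{P_0}(Y)\le t\}$, $t\in[0,1]$. $H$ also denotes the law with this CDF, and $U$ is the uniform law on $[0,1]$. *)

theory Defs
  imports "HOL-Probability.Probability"
begin

abbreviation unif :: "real measure" where
  "unif \<equiv> uniform_measure lborel {0..1}"

(* One row of the array together with its randomizers, as a law on pairs of sequences
   (x, u) indexed by j >= 1.  All coordinates are independent. *)
definition row_law :: "real measure \<Rightarrow> nat \<Rightarrow> real measure \<Rightarrow>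
    ((nat \<Rightarrow> real) \<times> (nat \<Rightarrow> real)) measure" where
  "row_law P0 T P1 =
     (\<Pi>\<^sub>M j\<in>{1..}. if j \<le> T then P0 else P1) \<Otimes>\<^sub>M (\<Pi>\<^sub>M j\<in>{1..}. unif)"

definition conformal_p :: "(nat \<Rightarrow> real) \<times> (nat \<Rightarrow> real) \<Rightarrow> nat \<Rightarrow> real" where
  "conformal_p \<omega> j =
     (real (card {i\<in>{1..j}. fst \<omega> i < fst \<omega> j})
        + snd \<omega> j * real (card {i\<in>{1..j}. fst \<omega> i = fst \<omega> j})) / real j"

(* The mixtures may be infinite, hence the values in ennreal.  Since p-values lie in [0,1]
   almost surely but not surely, the f \<theta> are functions on the whole line; only their
   restrictions to [0,1] matter. *)
definition mix_family :: "'t measure \<Rightarrow> ('t \<Rightarrow> real \<Rightarrow> real) \<Rightarrow> bool" where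
  "mix_family Q f \<longleftrightarrow>
     prob_space Q \<and>
     (\<lambda>(\<theta>, u). f \<theta> u) \<in> borel_measurable (Q \<Otimes>\<^sub>M borel) \<and>
     (\<forall>\<theta>\<in>space Q. (\<forall>u\<in>{0..1}. 0 \<le> f \<theta> u) \<and>
        (\<integral>\<^sup>+u\<in>{0..1}. ennreal (f \<theta> u) \<partial>lborel) = 1)"

definition mix_stat :: "'t measure \<Rightarrow> ('t \<Rightarrow> real \<Rightarrow> real) \<Rightarrow> (nat \<Rightarrow> real) \<Rightarrow> nat \<Rightarrow> nat \<Rightarrow> ennreal" where
  "mix_stat Q f p k t = (\<integral>\<^sup>+\<theta>. ennreal (\<Prod>j=k..t. f \<theta> (p j)) \<partial>Q)"

definition sum_stat :: "'t measure \<Rightarrow> ('t \<Rightarrow> real \<Rightarrow> real) \<Rightarrow> (nat \<Rightarrow> real) \<Rightarrow> (nat \<Rightarrow> real) \<Rightarrow> nat \<Rightarrow> ennreal" where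
  "sum_stat Q f w p t = (\<Sum>k=1..t. ennreal (w k) * mix_stat Q f p k t)"

definition max_stat :: "'t measure \<Rightarrow> ('t \<Rightarrow> real \<Rightarrow> real) \<Rightarrow> (nat \<Rightarrow> real) \<Rightarrow> (nat \<Rightarrow> real) \<Rightarrow> nat \<Rightarrow> ennreal" where
  "max_stat Q f w p t = Max ((\<lambda>k. ennreal (w k) * mix_stat Q f p k t) ` {1..t})"

(* Infimum in enat, so that the empty set yields \<infinity>. *)
definition first_passage :: "(nat \<Rightarrow> ennreal) \<Rightarrow> real \<Rightarrow> enat" where
  "first_passage S b = Inf (enat ` {t. 1 \<le> t \<and> ennreal b \<le> S t})"

definition tau_sum :: "'t measure \<Rightarrow> ('t \<Rightarrow> real \<Rightarrow> real) \<Rightarrow> (nat \<Rightarrow> real) \<Rightarrow> real \<Rightarrow>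
    (nat \<Rightarrow> real) \<times> (nat \<Rightarrow> real) \<Rightarrow> enat" where
  "tau_sum Q f w b \<omega> = first_passage (sum_stat Q f w (conformal_p \<omega>)) b"

definition tau_max :: "'t measure \<Rightarrow> ('t \<Rightarrow> real \<Rightarrow> real) \<Rightarrow> (nat \<Rightarrow> real) \<Rightarrow> real \<Rightarrow>
    (nat \<Rightarrow> real) \<times> (nat \<Rightarrow> real) \<Rightarrow> enat" where
  "tau_max Q f w b \<omega> = first_passage (max_stat Q f w (conformal_p \<omega>)) b"

definition ennreal_log :: "ennreal \<Rightarrow> ereal" where
  "ennreal_log x = (if x = 0 then -\<infinity> else if x = \<infinity> then \<infinity> else ereal (ln (enn2real x)))"

(* Division in ennreal gives b / 0 = \<infinity> for b > 0, whose logarithm is \<infinity>. *)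
definition log_budget :: "(nat \<Rightarrow> real) \<Rightarrow> nat \<Rightarrow> real \<Rightarrow> ereal" where
  "log_budget w T b = ennreal_log (ennreal b / ennreal (w (T + 1)))"

definition post_cdf :: "real measure \<Rightarrow> real measure \<Rightarrow> real \<Rightarrow> real" where
  "post_cdf P0 P1 t = measure P1 {y\<in>space P1. cdf P0 y \<le> t}"

definition post_law :: "real measure \<Rightarrow> real measure \<Rightarrow> real measure" where
  "post_law P0 P1 = distr P1 borel (cdf P0)"

lemma cdf_post_law:
  assumes "real_distribution P0" "real_distribution P1"
  shows "cdf (post_law P0 P1) t = post_cdf P0 P1 t"
proof -
  interpret p0: real_distribution P0 by fact
  interpret p1: real_distribution P1 by fact
  have "cdf P0 \<in> borel_measurable borel"
    by (intro borel_measurable_mono monoI p0.cdf_nondecreasing)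
  then have "cdf P0 \<in> measurable P1 borel"
    by (simp add: measurable_def)
  then show ?thesis
    unfolding post_law_def post_cdf_def cdf_def
    by (subst measure_distr) (auto intro!: arg_cong[where f = "measure P1"])
qed

(* The least Lipschitz constant; meaningful for functions that are Lipschitz on S. *)
definition lipschitz_const :: "real set \<Rightarrow> (real \<Rightarrow> real) \<Rightarrow> real" where
  "lipschitz_const S g = Inf {L. L-lipschitz_on S g}"

definition oscillation :: "real set \<Rightarrow> (real \<Rightarrow> real) \<Rightarrow> real" where
  "oscillation S g = (SUP u\<in>S. g u) - (INF u\<in>S. g u)"

end

(*
  Dvoretzky-Kiefer-Wolfowitz-Massart is not needed.  Only the average over the r post-change
  positions j of |A_j - F(X_j)| matters, where F is the pre-change CDF and A_j is the randomized rank
  of X_j among the first T observations.  Given X_j and its randomizer, A_j is a mean of T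
  independent variables in [0,1] with expectation F(X_j), so Hoeffding's lemma and Jensen's
  inequality bound the exponential moment of the average by 2 exp(l^2 / (8 T)), and Chernoff gives
  2 exp(-2 T s^2).  The p-value differs from A_j by at most r / T, the scores log h(F(X_j)) are iid
  with mean D, and Lipschitz continuity of log h together with the support condition turns the two
  deviation events into a lower bound on the mixture started at T + 1.
*)
theory Submission
  imports Defs
begin

section \<open>Lipschitz constants, Hoeffding's lemma and Chernoff's bound\<close>

text \<open>For x \<noteq> y the quotient \<open>dist (g x) (g y) / dist x y\<close> is a lower
  bound of the set of admissible constants, hence at most its infimum. The constant \<open>C\<close>
  makes that set nonempty, so the infimum is meaningful.\<close>

lemma lipschitz_on_lipschitz_const:
  assumes "C-lipschitz_on S g"
  shows "(lipschitz_const S g)-lipschitz_on S g"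
proof (rule lipschitz_onI)
  let ?A = "{L. L-lipschitz_on S g}"
  have ne: "?A \<noteq> {}"
    using assms by auto
  show "0 \<le> lipschitz_const S g"
    unfolding lipschitz_const_def
    by (intro cInf_greatest[OF ne]) (auto dest: lipschitz_on_nonneg)
  fix x y assume xy: "x \<in> S" "y \<in> S"
  show "dist (g x) (g y) \<le> lipschitz_const S g * dist x y"
  proof (cases "x = y")
    case False
    then have pos: "0 < dist x y" by simp
    have "dist (g x) (g y) / dist x y \<le> Inf ?A"
      using pos xy
      by (intro cInf_greatest[OF ne]) (auto simp: pos_divide_le_eq dest: lipschitz_onD)
    then show ?thesis
      using pos by (simp add: lipschitz_const_def pos_divide_le_eq)
  qed simp
qed

text \<open>For negative \<open>l\<close> the positive case applies to \<open>- f\<close>, whose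
  values fill an interval of the same length. Both signs occur later: lower tails use
  \<open>- l\<close>, and absolute deviations use \<open>l\<close> and \<open>- l\<close>
  together.\<close>

lemma (in prob_space) Hoeffdings_lemma_any_sign:
  assumes [measurable]: "random_variable borel f" and bnd: "\<And>x. x \<in> space M \<Longrightarrow> f x \<in> {\<alpha>..\<beta>}"
  shows "(\<integral>\<^sup>+x. ennreal (exp (l * (f x - expectation f))) \<partial>M) \<le> ennreal (exp (l\<^sup>2 * (\<beta> - \<alpha>)\<^sup>2 / 8))"
proof -
  consider "l > 0" | "l = 0" | "l < 0" by linarith
  then show ?thesis
  proof cases
    case 1
    interpret interval_bounded_random_variable M f \<alpha> \<beta>
      using bnd by unfold_locales auto
    show ?thesis
      using Hoeffdings_lemma_nn_integral[OF 1] .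
  next
    case 2
    then show ?thesis by (simp add: emeasure_space_1)
  next
    case 3
    interpret interval_bounded_random_variable M "\<lambda>x. - f x" "- \<beta>" "- \<alpha>"
      using bnd by unfold_locales auto
    show ?thesis
      using Hoeffdings_lemma_nn_integral[of "- l"] 3
      by (simp add: algebra_simps power2_commute)
  qed
qed

text \<open>Markov's inequality for exp (l Z): since l \<ge> 0, the event forces exp (- l e) exp (l
  Z) \<ge> 1.\<close>

lemma (in prob_space) Chernoff_bound:
  assumes [measurable]: "random_variable borel Z" and l: "0 \<le> l"
    and mgf: "(\<integral>\<^sup>+x. ennreal (exp (l * Z x)) \<partial>M) \<le> ennreal B" and B: "0 \<le> B"
  shows "\<P>(x in M. e \<le> Z x) \<le> B * exp (- l * e)"
proof -
  let ?c = "ennreal (exp (- l * e))"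
  have "emeasure M {x\<in>space M. e \<le> Z x}
      \<le> emeasure M {x\<in>space M. 1 \<le> ?c * ennreal (exp (l * Z x))}"
    using l by (intro emeasure_mono)
      (auto simp: ennreal_mult'[symmetric] exp_add[symmetric] mult_left_mono)
  also have "\<dots> \<le> ?c * (\<integral>\<^sup>+x. ennreal (exp (l * Z x)) * indicator (space M) x \<partial>M)"
    by (intro nn_integral_Markov_inequality) auto
  also have "\<dots> = ?c * (\<integral>\<^sup>+x. ennreal (exp (l * Z x)) \<partial>M)"
    by (intro arg_cong2[where f = "(*)"] refl nn_integral_cong) (auto simp: indicator_def)
  also have "\<dots> \<le> ?c * ennreal B"
    by (intro mult_left_mono mgf) auto
  also have "\<dots> = ennreal (B * exp (- l * e))"
    using B by (simp add: ennreal_mult'[symmetric] mult.commute)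
  finally show ?thesis
    using B by (simp add: emeasure_eq_measure)
qed

section \<open>Integrals over infinite products\<close>

text \<open>The image of the infinite product under restriction to finite \<open>J\<close> is the
  product over \<open>J\<close>. This carries integrals over whole rows to finite products, where
  Fubini's theorem is at hand.\<close>

lemma (in product_prob_space) nn_integral_PiM_finite_dependence:
  assumes J: "finite J" "J \<subseteq> I" and [measurable]: "g \<in> borel_measurable (PiM J M)"
  shows "(\<integral>\<^sup>+x. g (restrict x J) \<partial>PiM I M) = integral\<^sup>N (PiM J M) g"
proof -
  have "integral\<^sup>N (PiM J M) g = integral\<^sup>N (distr (PiM I M) (PiM J M) (\<lambda>x. restrict x J)) g"
    using J by (simp add: distr_PiM_restrict_finite)
  also have "\<dots> = (\<integral>\<^sup>+x. g (restrict x J) \<partial>PiM I M)"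
    using J by (intro nn_integral_distr) (auto intro: measurable_restrict_subset)
  finally show ?thesis ..
qed

lemma (in product_prob_space) nn_integral_PiM_prod:
  assumes J: "finite J" "J \<subseteq> I" and g[measurable]: "\<And>j. j \<in> J \<Longrightarrow> g j \<in> borel_measurable (M j)"
  shows "(\<integral>\<^sup>+x. (\<Prod>j\<in>J. g j (x j)) \<partial>PiM I M) = (\<Prod>j\<in>J. integral\<^sup>N (M j) (g j))"
proof -
  have "(\<integral>\<^sup>+x. (\<Prod>j\<in>J. g j (x j)) \<partial>PiM I M) = (\<integral>\<^sup>+x. (\<Prod>j\<in>J. g j (restrict x J j)) \<partial>PiM I M)"
    by simp
  also have "\<dots> = (\<integral>\<^sup>+x. (\<Prod>j\<in>J. g j (x j)) \<partial>PiM J M)"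
    using J by (intro nn_integral_PiM_finite_dependence) auto
  also have "\<dots> = (\<Prod>j\<in>J. integral\<^sup>N (M j) (g j))"
    using J(1) g by (rule product_nn_integral_prod)
  finally show ?thesis .
qed

text \<open>This is conditioning on the coordinate \<open>k\<close>: Fubini isolates it, and with
  its value y frozen the remaining factors are independent. Below, \<open>k\<close> is a post-change
  position and \<open>J\<close> the pre-change sample.\<close>

lemma (in product_prob_space) nn_integral_PiM_prod_conditional:
  assumes J: "finite J" "J \<subseteq> I" and k: "k \<in> I" "k \<notin> J"
    and g: "\<And>j. j \<in> J \<Longrightarrow> (\<lambda>(y, x). g j y x) \<in> borel_measurable (M k \<Otimes>\<^sub>M M j)"
  shows "(\<integral>\<^sup>+x. (\<Prod>j\<in>J. g j (x k) (x j)) \<partial>PiM I M) = (\<integral>\<^sup>+y. (\<Prod>j\<in>J. \<integral>\<^sup>+x. g j y x \<partial>M j) \<partial>M k)"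
proof -
  let ?K = "insert k J"
  have meas: "(\<lambda>x. g j (x k) (x j)) \<in> borel_measurable (PiM ?K M)" if j: "j \<in> J" for j
  proof -
    have "(\<lambda>x. (x k, x j)) \<in> measurable (PiM ?K M) (M k \<Otimes>\<^sub>M M j)"
      using j by (intro measurable_Pair measurable_component_singleton) auto
    from measurable_compose[OF this g[OF j]] show ?thesis by simp
  qed
  let ?G = "\<lambda>x. \<Prod>j\<in>J. g j (x k) (x j)"
  have G: "?G \<in> borel_measurable (PiM ?K M)"
    by (rule borel_measurable_prod_ennreal) (rule meas)
  have "(\<integral>\<^sup>+x. ?G x \<partial>PiM I M) = (\<integral>\<^sup>+x. ?G (restrict x ?K) \<partial>PiM I M)"
    by simp
  also have "\<dots> = integral\<^sup>N (PiM ?K M) ?G"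
    using J k G by (intro nn_integral_PiM_finite_dependence) auto
  also have "\<dots> = (\<integral>\<^sup>+y. (\<integral>\<^sup>+x. ?G (x(k := y)) \<partial>PiM J M) \<partial>M k)"
    by (rule product_nn_integral_insert_rev[OF J(1) k(2) G])
  also have "\<dots> = (\<integral>\<^sup>+y. (\<integral>\<^sup>+x. (\<Prod>j\<in>J. g j y (x j)) \<partial>PiM J M) \<partial>M k)"
    using k by (intro nn_integral_cong prod.cong refl) auto
  also have "\<dots> = (\<integral>\<^sup>+y. (\<Prod>j\<in>J. \<integral>\<^sup>+x. g j y x \<partial>M j) \<partial>M k)"
  proof (intro nn_integral_cong product_nn_integral_prod J(1))
    fix y j assume y: "y \<in> space (M k)" and j: "j \<in> J"
    show "g j y \<in> borel_measurable (M j)"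
      using measurable_compose[OF measurable_Pair1'[OF y] g[OF j]] by simp
  qed
  finally show ?thesis .
qed

section \<open>Convexity of the exponential\<close>

text \<open>Jensen's inequality with equal weights, followed by exp (l |v|) \<le> exp (l v) + exp (-
  l v), where one of the two terms on the right is the left side.\<close>

lemma exp_abs_average_le:
  fixes v :: "'a \<Rightarrow> real"
  assumes J: "finite J" "J \<noteq> {}"
  shows "exp (l * ((\<Sum>j\<in>J. \<bar>v j\<bar>) / real (card J)))
    \<le> (\<Sum>j\<in>J. exp (l * v j) + exp (- l * v j)) / real (card J)"
proof -
  have card: "0 < card J"
    using J by (simp add: card_gt_0_iff)
  have "exp (\<Sum>j\<in>J. (1 / real (card J)) *\<^sub>R (l * \<bar>v j\<bar>))
      \<le> (\<Sum>j\<in>J. (1 / real (card J)) * exp (l * \<bar>v j\<bar>))"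
    using card by (intro convex_on_sum[OF J exp_convex]) auto
  also have "\<dots> \<le> (\<Sum>j\<in>J. (1 / real (card J)) * (exp (l * v j) + exp (- l * v j)))"
    by (intro sum_mono mult_left_mono) (auto simp: abs_if)
  finally show ?thesis
    by (simp add: sum_divide_distrib sum_distrib_left)
qed

section \<open>Conformal p-values and pre-change ranks\<close>

text \<open>The summand of the conformal p-value: what \<open>x\<close> contributes to the rank of
  \<open>y\<close> when the randomizer is \<open>u\<close>. The order of arguments makes
  \<open>rank_score u y\<close> a random variable in the reference observation.\<close>

definition rank_score :: "real \<Rightarrow> real \<Rightarrow> real \<Rightarrow> real" where
  "rank_score u y x = of_bool (x < y) + u * of_bool (x = y)"

lemma rank_score_bounds: "u \<in> {0..1} \<Longrightarrow> rank_score u y x \<in> {0..1}"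
  by (auto simp: rank_score_def)

lemma rank_score_measurable[measurable (raw)]:
  assumes [measurable]: "u \<in> borel_measurable M" "y \<in> borel_measurable M" "x \<in> borel_measurable M"
  shows "(\<lambda>z. rank_score (u z) (y z) (x z)) \<in> borel_measurable M"
  unfolding rank_score_def by measurable

lemma conformal_p_eq_rank_scores:
  "conformal_p \<omega> j = (\<Sum>i=1..j. rank_score (snd \<omega> j) (fst \<omega> j) (fst \<omega> i)) / real j"
proof -
  have card: "real (card {i \<in> {1..j}. R i}) = (\<Sum>i=1..j. of_bool (R i))" for R
  proof -
    have "{i \<in> {1..j}. R i} = {1..j} \<inter> {i. R i}" by auto
    then show ?thesis by simp
  qed
  show ?thesis
    unfolding conformal_p_def rank_score_def card sum.distrib sum_distrib_left ..
qed

lemma conformal_p_bounds: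
  assumes "snd \<omega> j \<in> {0..1}" "1 \<le> j"
  shows "conformal_p \<omega> j \<in> {0..1}"
proof -
  have "(\<Sum>i=1..j. rank_score (snd \<omega> j) (fst \<omega> j) (fst \<omega> i)) \<le> of_nat (card {1..j}) * 1"
    using rank_score_bounds[OF assms(1)] by (intro sum_bounded_above) auto
  moreover have "0 \<le> (\<Sum>i=1..j. rank_score (snd \<omega> j) (fst \<omega> j) (fst \<omega> i))"
    using rank_score_bounds[OF assms(1)] by (intro sum_nonneg) auto
  ultimately show ?thesis
    using assms(2) by (simp add: conformal_p_eq_rank_scores divide_le_eq)
qed

text \<open>A continuous CDF has no atoms, so ties with \<open>y\<close> are null. Almost surely the
  score is then the indicator of \<open>{..y}\<close>, whatever the randomizer.\<close>

lemma (in real_distribution) expectation_rank_score: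
  assumes "continuous_on UNIV (cdf M)"
  shows "expectation (rank_score u y) = cdf M y"
proof -
  have "measure M {y} = 0"
    using assms isCont_cdf[of y] by (simp add: continuous_on_eq_continuous_at)
  then have tie: "AE x in M. x \<noteq> y"
    by (intro AE_I[of _ _ "{y}"]) (auto simp: emeasure_eq_measure)
  have "expectation (rank_score u y) = expectation (indicator {..y})"
  proof (rule integral_cong_AE)
    show "rank_score u y \<in> borel_measurable M"
      by (rule rank_score_measurable) auto
    show "AE x in M. rank_score u y x = indicator {..y} x"
      using tie by eventually_elim (auto simp: rank_score_def indicator_def)
  qed simp
  then show ?thesis
    by (simp add: cdf_def)
qed

text \<open>The quantity A_j of the overview. Only pre-change observations enter as references, so
  for j > T they are independent of X_j and its randomizer.\<close>

definition reference_rank :: "nat \<Rightarrow> (nat \<Rightarrow> real) \<times> (nat \<Rightarrow> real) \<Rightarrow> nat \<Rightarrow> real" where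
  "reference_rank T \<omega> j = (\<Sum>i=1..T. rank_score (snd \<omega> j) (fst \<omega> j) (fst \<omega> i)) / real T"

text \<open>With S and N the score sums over 1..T and T+1..j, the difference equals (N - (j - T) S /
  T) / j. Both terms of the numerator lie in [0, j - T], and (j - T) / j \<le> r / T.\<close>

lemma conformal_p_near_reference_rank:
  assumes u: "snd \<omega> j \<in> {0..1}" and T: "1 \<le> T" and j: "T < j" "j \<le> T + r"
  shows "\<bar>conformal_p \<omega> j - reference_rank T \<omega> j\<bar> \<le> real r / real T"
proof -
  define z where "z i = rank_score (snd \<omega> j) (fst \<omega> j) (fst \<omega> i)" for i
  have z: "0 \<le> z i" "z i \<le> 1" for i
    using rank_score_bounds[OF u] by (auto simp: z_def)
  define S N where "S = sum z {1..T}" and "N = sum z {Suc T..j}"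
  have split: "sum z {1..j} = S + N"
    using j T sum.ub_add_nat[of 1 T z "j - T"] by (simp add: S_def N_def)
  have S: "0 \<le> S" "S \<le> real T"
    using sum_bounded_above[of "{1..T}" z 1] z by (auto simp: S_def intro: sum_nonneg)
  have N: "0 \<le> N" "N \<le> real (j - T)"
    using sum_bounded_above[of "{Suc T..j}" z 1] z by (auto simp: N_def intro: sum_nonneg)
  have Tj: "0 < real T" "real T \<le> real j" "real (j - T) = real j - real T"
    using T j by auto
  have "conformal_p \<omega> j - reference_rank T \<omega> j = (S + N) / real j - S / real T"
    using split by (simp add: conformal_p_eq_rank_scores reference_rank_def z_def S_def)
  also have "\<dots> = (N - real (j - T) * (S / real T)) / real j"
  proof -
    have "S + N = S / real T * real T + N"
      using Tj by simp
    then have "(S + N) / real j = ((N - (real j - real T) * (S / real T)) + real j * (S / real T)) / real j"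
      by (simp add: algebra_simps)
    then show ?thesis
      unfolding Tj(3) add_divide_distrib[of _ "real j * _"] using Tj by simp
  qed
  also have "\<bar>\<dots>\<bar> \<le> real (j - T) / real j"
  proof -
    have "0 \<le> real (j - T) * (S / real T)" "real (j - T) * (S / real T) \<le> real (j - T) * 1"
      using S Tj(1) by (auto intro!: mult_left_mono simp: divide_le_eq simp del: of_nat_diff)
    then have "\<bar>N - real (j - T) * (S / real T)\<bar> \<le> real (j - T)"
      using N by linarith
    then show ?thesis
      by (simp add: divide_right_mono)
  qed
  also have "\<dots> \<le> real r / real T"
    using Tj j by (intro frac_le) auto
  finally show ?thesis .
qed

section \<open>Law of one row\<close>

lemma prob_space_unif: "prob_space unif"
  by (rule prob_space_uniform_measure) auto

lemma AE_unif: "AE u in unif. u \<in> {0..1}"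
  by (rule AE_uniform_measureI) auto

text \<open>The bounds are non-asymptotic, so one row with a fixed changepoint is studied at a
  time.\<close>

locale changepoint_row = P0: real_distribution P0 + P1: real_distribution P1
  for P0 P1 :: "real measure" +
  fixes T :: nat
  assumes T_pos: "1 \<le> T"
begin

abbreviation obs_law :: "nat \<Rightarrow> real measure" where
  "obs_law j \<equiv> if j \<le> T then P0 else P1"

abbreviation row :: "((nat \<Rightarrow> real) \<times> (nat \<Rightarrow> real)) measure" where
  "row \<equiv> row_law P0 T P1"

sublocale X: product_prob_space obs_law "{1..}"
  by (intro product_prob_spaceI) (auto intro: P0.prob_space_axioms P1.prob_space_axioms)

sublocale \<Lambda>: product_prob_space "\<lambda>_. unif" "{1..}"
  by (intro product_prob_spaceI prob_space_unif)

sublocale row: pair_prob_space "PiM {1..} obs_law" "PiM {1..} (\<lambda>_. unif)" ..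

lemma prob_space_row: "prob_space row"
  unfolding row_law_def by (rule row.prob_space_axioms)

lemma obs_measurable[measurable]: "1 \<le> j \<Longrightarrow> (\<lambda>\<omega>. fst \<omega> j) \<in> borel_measurable row"
proof -
  assume "1 \<le> j"
  then have "(\<lambda>\<omega>. fst \<omega> j) \<in> measurable row (obs_law j)"
    unfolding row_law_def by (intro measurable_compose[OF measurable_fst] measurable_component_singleton) auto
  moreover have "measurable row (obs_law j) = borel_measurable row"
    by (intro measurable_cong_sets) auto
  ultimately show ?thesis
    by simp
qed

lemma randomizer_measurable[measurable]: "1 \<le> j \<Longrightarrow> (\<lambda>\<omega>. snd \<omega> j) \<in> borel_measurable row"
proof -
  assume "1 \<le> j"
  then have "(\<lambda>\<omega>. snd \<omega> j) \<in> measurable row unif"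
    unfolding row_law_def by (intro measurable_compose[OF measurable_snd] measurable_component_singleton) auto
  moreover have "measurable row unif = borel_measurable row"
    by (intro measurable_cong_sets) auto
  ultimately show ?thesis
    by simp
qed

text \<open>Countably many null sets are removed at once. Off them all p-values lie in [0,1], where
  the Lipschitz and support conditions apply.\<close>

lemma AE_randomizers: "AE \<omega> in row. \<forall>j\<in>{1..}. snd \<omega> j \<in> {0..1}"
proof (rule AE_ball_countable')
  fix j :: nat assume j: "j \<in> {1..}"
  have meas: "{\<omega>\<in>space row. snd \<omega> j \<in> {0..1}} \<in> sets row"
    using measurable_sets_Collect[OF randomizer_measurable[of j], of "\<lambda>u. u \<in> {0..1}"] j by simp
  have "AE u in PiM {1..} (\<lambda>_. unif). u j \<in> {0..1}"
    using j by (intro AE_PiM_component prob_space_unif AE_unif)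
  then show "AE \<omega> in row. snd \<omega> j \<in> {0..1}"
    using meas unfolding row_law_def by (intro row.AE_pair_measure) auto
qed simp

lemma nn_integral_obs:
  assumes [measurable]: "g \<in> borel_measurable (PiM {1..} obs_law)"
  shows "(\<integral>\<^sup>+\<omega>. g (fst \<omega>) \<partial>row) = integral\<^sup>N (PiM {1..} obs_law) g"
proof -
  have "(\<lambda>\<omega>. g (fst \<omega>)) \<in> borel_measurable (PiM {1..} obs_law \<Otimes>\<^sub>M PiM {1..} (\<lambda>_. unif))"
    by (intro measurable_compose[OF measurable_fst assms])
  from row.nn_integral_snd[OF this, symmetric] show ?thesis
    unfolding row_law_def by (simp add: \<Lambda>.P.emeasure_space_1 del: One_nat_def)
qed

section \<open>Deviation of scores and ranks\<close>

text \<open>Hoeffding's inequality by Chernoff's method: all indices exceed T, so the summands are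
  independent with law \<open>P1\<close>, and Hoeffding's lemma at \<open>- l\<close> bounds each
  factor.\<close>

lemma post_change_sum_lower_tail:
  assumes [measurable]: "g \<in> borel_measurable borel" and bnd: "\<And>y. g y \<in> {\<alpha>..\<beta>}"
    and r: "1 \<le> r" and x: "0 < x" and K: "\<alpha> < \<beta>"
  shows "\<P>(\<omega> in row. (\<Sum>j\<in>{T<..T+r}. g (fst \<omega> j)) \<le> real r * P1.expectation g - x)
      \<le> exp (- (2 * x\<^sup>2 / (real r * (\<beta> - \<alpha>)\<^sup>2)))"
proof -
  interpret row': prob_space row by (rule prob_space_row)
  let ?J = "{T<..T+r}" and ?m = "P1.expectation g"
  define Z where "Z \<omega> = (\<Sum>j\<in>?J. ?m - g (fst \<omega> j))" for \<omega> :: "(nat \<Rightarrow> real) \<times> (nat \<Rightarrow> real)"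
  \<comment> \<open>This \<open>l\<close> minimizes the exponent r l^2 (\<beta> - \<alpha>)^2 / 8 -
    l x.\<close>
  define l where "l = 4 * x / (real r * (\<beta> - \<alpha>)\<^sup>2)"
  have l: "0 < l"
    using r x K by (simp add: l_def)
  have [measurable]: "Z \<in> borel_measurable row"
    unfolding Z_def
    by (intro borel_measurable_sum borel_measurable_diff measurable_compose[OF obs_measurable, of _ g]) auto
  have "(\<integral>\<^sup>+\<omega>. ennreal (exp (l * Z \<omega>)) \<partial>row)
      = (\<integral>\<^sup>+\<omega>. (\<Prod>j\<in>?J. ennreal (exp (- l * (g (fst \<omega> j) - ?m)))) \<partial>row)"
    by (intro nn_integral_cong)
       (simp add: Z_def prod_ennreal exp_sum[symmetric] sum_distrib_left algebra_simps)
  also have "\<dots> = (\<integral>\<^sup>+x. (\<Prod>j\<in>?J. ennreal (exp (- l * (g (x j) - ?m)))) \<partial>PiM {1..} obs_law)"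
    by (rule nn_integral_obs) (auto intro!: borel_measurable_prod_ennreal measurable_compose[OF measurable_component_singleton])
  also have "\<dots> = (\<Prod>j\<in>?J. \<integral>\<^sup>+y. ennreal (exp (- l * (g y - ?m))) \<partial>obs_law j)"
    by (rule X.nn_integral_PiM_prod) auto
  also have "\<dots> = (\<Prod>j\<in>?J. \<integral>\<^sup>+y. ennreal (exp (- l * (g y - ?m))) \<partial>P1)"
    by (intro prod.cong) auto
  also have "\<dots> \<le> (\<Prod>j\<in>?J. ennreal (exp ((- l)\<^sup>2 * (\<beta> - \<alpha>)\<^sup>2 / 8)))"
    using bnd by (intro prod_mono_ennreal P1.Hoeffdings_lemma_any_sign) auto
  also have "\<dots> = ennreal (exp (real r * (l\<^sup>2 * (\<beta> - \<alpha>)\<^sup>2 / 8)))"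
    by (simp add: ennreal_power exp_of_nat_mult[symmetric] algebra_simps)
  finally have "row'.prob {\<omega>\<in>space row. x \<le> Z \<omega>}
      \<le> exp (real r * (l\<^sup>2 * (\<beta> - \<alpha>)\<^sup>2 / 8)) * exp (- l * x)"
    using l by (intro row'.Chernoff_bound) auto
  also have "\<dots> = exp (real r * (l\<^sup>2 * (\<beta> - \<alpha>)\<^sup>2 / 8) - l * x)"
    by (simp add: exp_add[symmetric])
  also have "real r * (l\<^sup>2 * (\<beta> - \<alpha>)\<^sup>2 / 8) - l * x = - (2 * x\<^sup>2 / (real r * (\<beta> - \<alpha>)\<^sup>2))"
  proof -
    define q where "q = real r * (\<beta> - \<alpha>)\<^sup>2"
    have q: "0 < q" and l_q: "l = 4 * x / q"
      using r K by (simp_all add: q_def l_def)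
    have "real r * (l\<^sup>2 * (\<beta> - \<alpha>)\<^sup>2 / 8) - l * x = l * (l * q / 8 - x)"
      by (simp add: q_def power2_eq_square algebra_simps)
    also have "\<dots> = - (2 * x\<^sup>2 / q)"
      using q by (simp add: l_q power2_eq_square)
    finally show ?thesis by (simp add: q_def)
  qed
  also have "{\<omega>\<in>space row. x \<le> Z \<omega>}
      = {\<omega>\<in>space row. (\<Sum>j\<in>?J. g (fst \<omega> j)) \<le> real r * ?m - x}"
    by (auto simp: Z_def sum_subtractf)
  finally show ?thesis .
qed

lemma reference_rank_measurable[measurable]:
  "1 \<le> j \<Longrightarrow> (\<lambda>\<omega>. reference_rank T \<omega> j) \<in> borel_measurable row"
  unfolding reference_rank_def
  by (intro borel_measurable_divide borel_measurable_sum rank_score_measurable) auto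

text \<open>Given X_j and its randomizer, the deviation is a sum of T independent centred terms
  scaled by 1 / T. Hoeffding's lemma at l / T on [0,1] gives (l / T)^2 / 8 for each, in total l^2 /
  (8 T).\<close>

lemma reference_rank_mgf:
  assumes cont: "continuous_on UNIV (cdf P0)" and j: "T < j"
  shows "(\<integral>\<^sup>+\<omega>. ennreal (exp (l * (reference_rank T \<omega> j - cdf P0 (fst \<omega> j)))) \<partial>row)
    \<le> ennreal (exp (l\<^sup>2 / (8 * real T)))"
proof -
  let ?F = "cdf P0"
  define G where "G u y x = ennreal (exp ((l / real T) * (rank_score u y x - ?F y)))" for u y x :: real
  have [measurable]: "?F \<in> borel_measurable borel"
    by (intro borel_measurable_mono monoI P0.cdf_nondecreasing)
  have meas: "(\<lambda>\<omega>. ennreal (exp (l * (reference_rank T \<omega> j - ?F (fst \<omega> j))))) \<in> borel_measurable row"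
    using j reference_rank_measurable[of j] measurable_compose[OF obs_measurable[of j], of ?F borel] by simp
  have prod: "ennreal (exp (l * (reference_rank T (x, u) j - ?F (x j)))) = (\<Prod>i\<in>{1..T}. G (u j) (x j) (x i))"
    for x u
  proof -
    have "l * (reference_rank T (x, u) j - ?F (x j))
        = (\<Sum>i=1..T. (l / real T) * (rank_score (u j) (x j) (x i) - ?F (x j)))"
      using T_pos by (simp add: reference_rank_def sum_subtractf right_diff_distrib sum_divide_distrib sum_distrib_left)
    then show ?thesis
      by (simp add: G_def prod_ennreal exp_sum)
  qed
  have cond: "(\<integral>\<^sup>+x. (\<Prod>i\<in>{1..T}. G (u j) (x j) (x i)) \<partial>PiM {1..} obs_law)
      \<le> ennreal (exp (l\<^sup>2 / (8 * real T)))" if u: "u j \<in> {0..1}" for u :: "nat \<Rightarrow> real"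
  proof -
    \<comment> \<open>Since j > T, the coordinate X_j lies outside the reference sample and can be
      conditioned on.\<close>
    have "(\<integral>\<^sup>+x. (\<Prod>i\<in>{1..T}. G (u j) (x j) (x i)) \<partial>PiM {1..} obs_law)
        = (\<integral>\<^sup>+y. (\<Prod>i\<in>{1..T}. \<integral>\<^sup>+z. G (u j) y z \<partial>obs_law i) \<partial>obs_law j)"
    proof (rule X.nn_integral_PiM_prod_conditional)
      fix i assume "i \<in> {1..T}"
      have "(\<lambda>(y, z). G (u j) y z) \<in> borel_measurable (borel \<Otimes>\<^sub>M borel)"
        unfolding G_def by measurable
      moreover have "sets (obs_law j) = sets borel" "sets (obs_law i) = sets borel"
        by auto
      ultimately show "(\<lambda>(y, z). G (u j) y z) \<in> borel_measurable (obs_law j \<Otimes>\<^sub>M obs_law i)"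
        by (simp cong: measurable_cong_sets sets_pair_measure_cong)
    qed (use j T_pos in auto)
    also have "\<dots> = (\<integral>\<^sup>+y. (\<Prod>i\<in>{1..T}. \<integral>\<^sup>+z. G (u j) y z \<partial>P0) \<partial>P1)"
      using j by (auto intro!: nn_integral_cong prod.cong)
    also have "\<dots> \<le> (\<integral>\<^sup>+y. (\<Prod>i\<in>{1..T}. ennreal (exp ((l / real T)\<^sup>2 * (1 - 0)\<^sup>2 / 8))) \<partial>P1)"
    proof (intro nn_integral_mono prod_mono_ennreal)
      fix y
      have "rank_score (u j) y \<in> borel_measurable P0"
        by (rule rank_score_measurable) auto
      from P0.Hoeffdings_lemma_any_sign[OF this, of 0 1 "l / real T"] rank_score_bounds[OF u]
      show "(\<integral>\<^sup>+z. G (u j) y z \<partial>P0) \<le> ennreal (exp ((l / real T)\<^sup>2 * (1 - 0)\<^sup>2 / 8))"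
        by (simp add: G_def P0.expectation_rank_score[OF cont])
    qed
    also have "\<dots> = ennreal (exp (real T * ((l / real T)\<^sup>2 / 8)))"
      using P1.emeasure_space_1 by (simp add: ennreal_power exp_of_nat_mult[symmetric] algebra_simps)
    also have "real T * ((l / real T)\<^sup>2 / 8) = l\<^sup>2 / (8 * real T)"
      using T_pos by (simp add: power2_eq_square)
    finally show ?thesis .
  qed
  \<comment> \<open>Fubini integrates the observations first with the randomizers frozen;
    \<open>cond\<close> then holds for almost every randomizer sequence.\<close>
  have "AE u in PiM {1..} (\<lambda>_. unif). u j \<in> {0..1}"
    using j by (intro AE_PiM_component prob_space_unif AE_unif) auto
  then have "AE u in PiM {1..} (\<lambda>_. unif). (\<integral>\<^sup>+x. (\<Prod>i\<in>{1..T}. G (u j) (x j) (x i)) \<partial>PiM {1..} obs_law)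
      \<le> ennreal (exp (l\<^sup>2 / (8 * real T)))"
    by eventually_elim (rule cond)
  then have "(\<integral>\<^sup>+u. (\<integral>\<^sup>+x. (\<Prod>i\<in>{1..T}. G (u j) (x j) (x i)) \<partial>PiM {1..} obs_law) \<partial>PiM {1..} (\<lambda>_. unif))
      \<le> (\<integral>\<^sup>+u. ennreal (exp (l\<^sup>2 / (8 * real T))) \<partial>PiM {1::nat..} (\<lambda>_. unif))"
    by (rule nn_integral_mono_AE)
  then show ?thesis
    using row.nn_integral_snd[OF meas[unfolded row_law_def]]
    unfolding row_law_def by (simp add: prod \<Lambda>.P.emeasure_space_1 del: One_nat_def)
qed

text \<open>The reference ranks share one pre-change sample and are dependent across j. Convexity
  reduces the exponential moment of the average to the individual moments, so neither independence
  across j nor a factor r from a union bound enters.\<close>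

lemma reference_rank_average_deviation:
  assumes cont: "continuous_on UNIV (cdf P0)" and r: "1 \<le> r" and s: "0 < s"
  shows "\<P>(\<omega> in row. real r * s \<le> (\<Sum>j\<in>{T<..T+r}. \<bar>reference_rank T \<omega> j - cdf P0 (fst \<omega> j)\<bar>))
      \<le> 2 * exp (- 2 * real T * s\<^sup>2)"
proof -
  interpret row': prob_space row by (rule prob_space_row)
  let ?J = "{T<..T+r}"
  define v where "v \<omega> j = reference_rank T \<omega> j - cdf P0 (fst \<omega> j)" for \<omega> j
  \<comment> \<open>The minimizer of l^2 / (8 T) - l s, with minimum - 2 T s^2.\<close>
  define l where "l = 4 * real T * s"
  define B where "B = exp (l\<^sup>2 / (8 * real T))"
  have J: "finite ?J" "?J \<noteq> {}" "card ?J = r"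
    using r by auto
  have F[measurable]: "cdf P0 \<in> borel_measurable borel"
    by (intro borel_measurable_mono monoI P0.cdf_nondecreasing)
  have v[measurable]: "(\<lambda>\<omega>. v \<omega> j) \<in> borel_measurable row" if "j \<in> ?J" for j
    unfolding v_def using that
    by (intro borel_measurable_diff reference_rank_measurable measurable_compose[OF obs_measurable F]) auto
  have "(\<integral>\<^sup>+\<omega>. ennreal (exp (l * ((\<Sum>j\<in>?J. \<bar>v \<omega> j\<bar>) / real r))) \<partial>row)
      \<le> (\<integral>\<^sup>+\<omega>. (\<Sum>j\<in>?J. ennreal (exp (l * v \<omega> j)) + ennreal (exp (- l * v \<omega> j))) * ennreal (1 / real r) \<partial>row)"
  proof (rule nn_integral_mono)
    fix \<omega>
    have "ennreal (exp (l * ((\<Sum>j\<in>?J. \<bar>v \<omega> j\<bar>) / real r)))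
        \<le> ennreal ((\<Sum>j\<in>?J. exp (l * v \<omega> j) + exp (- l * v \<omega> j)) * (1 / real r))"
      using exp_abs_average_le[OF J(1,2), of l "v \<omega>"] by (intro ennreal_leI) (simp add: J(3))
    also have "\<dots> = ennreal (\<Sum>j\<in>?J. exp (l * v \<omega> j) + exp (- l * v \<omega> j)) * ennreal (1 / real r)"
      by (intro ennreal_mult sum_nonneg add_nonneg_nonneg) auto
    also have "ennreal (\<Sum>j\<in>?J. exp (l * v \<omega> j) + exp (- l * v \<omega> j))
        = (\<Sum>j\<in>?J. ennreal (exp (l * v \<omega> j)) + ennreal (exp (- l * v \<omega> j)))"
      by (subst sum_ennreal[symmetric]) (auto simp: add_nonneg_nonneg)
    finally show "ennreal (exp (l * ((\<Sum>j\<in>?J. \<bar>v \<omega> j\<bar>) / real r)))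
        \<le> (\<Sum>j\<in>?J. ennreal (exp (l * v \<omega> j)) + ennreal (exp (- l * v \<omega> j))) * ennreal (1 / real r)" .
  qed
  also have "\<dots> = (\<Sum>j\<in>?J. (\<integral>\<^sup>+\<omega>. ennreal (exp (l * v \<omega> j)) \<partial>row)
      + (\<integral>\<^sup>+\<omega>. ennreal (exp (- l * v \<omega> j)) \<partial>row)) * ennreal (1 / real r)"
  proof -
    have m: "(\<lambda>\<omega>. ennreal (exp (k * v \<omega> j))) \<in> borel_measurable row" if "j \<in> ?J" for j k
      using v[OF that] by simp
    have "(\<integral>\<^sup>+\<omega>. (\<Sum>j\<in>?J. ennreal (exp (l * v \<omega> j)) + ennreal (exp (- l * v \<omega> j))) \<partial>row)
        = (\<Sum>j\<in>?J. \<integral>\<^sup>+\<omega>. ennreal (exp (l * v \<omega> j)) + ennreal (exp (- l * v \<omega> j)) \<partial>row)"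
      by (rule nn_integral_sum) (intro borel_measurable_add m)
    also have "\<dots> = (\<Sum>j\<in>?J. (\<integral>\<^sup>+\<omega>. ennreal (exp (l * v \<omega> j)) \<partial>row)
        + (\<integral>\<^sup>+\<omega>. ennreal (exp (- l * v \<omega> j)) \<partial>row))"
      by (rule sum.cong[OF refl], rule nn_integral_add) (rule m, assumption)+
    finally show ?thesis
      by (subst nn_integral_multc) (rule borel_measurable_sum, rule borel_measurable_add, (rule m, assumption)+, rule arg_cong2[where f = "(*)"], assumption, rule refl)
  qed
  \<comment> \<open>The moment bound is even in \<open>l\<close>, so both signs contribute the same
    \<open>B\<close>; hence the factor 2.\<close>
  also have "\<dots> \<le> (\<Sum>j\<in>?J. ennreal B + ennreal B) * ennreal (1 / real r)"
    using reference_rank_mgf[OF cont, of _ l] reference_rank_mgf[OF cont, of _ "- l"]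
    by (intro mult_right_mono sum_mono add_mono) (auto simp: v_def B_def)
  also have "\<dots> = ennreal (2 * B)"
  proof -
    have "ennreal B + ennreal B = ennreal (2 * B)"
      by (subst ennreal_plus[symmetric]) (auto simp: B_def)
    then have "(\<Sum>j\<in>?J. ennreal B + ennreal B) = ennreal (real r * (2 * B))"
      by (simp add: ennreal_of_nat_eq_real_of_nat ennreal_mult')
    moreover have "ennreal (real r * (2 * B)) * ennreal (1 / real r) = ennreal (real r * (2 * B) * (1 / real r))"
      by (rule ennreal_mult[symmetric]) (auto simp: B_def)
    ultimately show ?thesis
      using r by simp
  qed
  finally have mgf: "(\<integral>\<^sup>+\<omega>. ennreal (exp (l * ((\<Sum>j\<in>?J. \<bar>v \<omega> j\<bar>) / real r))) \<partial>row) \<le> ennreal (2 * B)" .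
  have "row'.prob {\<omega>\<in>space row. s \<le> (\<Sum>j\<in>?J. \<bar>v \<omega> j\<bar>) / real r} \<le> 2 * B * exp (- l * s)"
    using s by (intro row'.Chernoff_bound mgf) (auto simp: l_def B_def)
  also have "\<dots> = 2 * exp (l\<^sup>2 / (8 * real T) - l * s)"
    by (simp add: B_def mult_exp_exp mult.assoc)
  also have "l\<^sup>2 / (8 * real T) - l * s = - 2 * real T * s\<^sup>2"
    using T_pos by (simp add: l_def power2_eq_square)
  also have "{\<omega>\<in>space row. s \<le> (\<Sum>j\<in>?J. \<bar>v \<omega> j\<bar>) / real r}
      = {\<omega>\<in>space row. real r * s \<le> (\<Sum>j\<in>?J. \<bar>v \<omega> j\<bar>)}"
    using r by (simp add: le_divide_eq mult.commute)
  finally show ?thesis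
    by (simp add: v_def)
qed

end

section \<open>First passage and thresholds\<close>

text \<open>A finite bound excludes the empty set, whose infimum is \<infinity>; a nonempty set of
  extended naturals attains its infimum.\<close>

lemma first_passage_le_iff:
  "first_passage S b \<le> enat N \<longleftrightarrow> (\<exists>t\<in>{1..N}. ennreal b \<le> S t)"
proof
  let ?A = "enat ` {t. 1 \<le> t \<and> ennreal b \<le> S t}"
  assume le: "first_passage S b \<le> enat N"
  then have "?A \<noteq> {}"
    by (auto simp: first_passage_def Inf_enat_def split: if_splits)
  then have "Inf ?A \<in> ?A"
    unfolding Inf_enat_def by (auto intro: LeastI)
  then show "\<exists>t\<in>{1..N}. ennreal b \<le> S t"
    using le by (auto simp: first_passage_def)
next
  assume "\<exists>t\<in>{1..N}. ennreal b \<le> S t"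
  then obtain t where t: "1 \<le> t" "t \<le> N" "ennreal b \<le> S t" by auto
  then have "first_passage S b \<le> enat t"
    unfolding first_passage_def by (intro Inf_lower) auto
  also have "\<dots> \<le> enat N"
    using t by simp
  finally show "first_passage S b \<le> enat N" .
qed

lemma max_stat_ge_iff:
  "1 \<le> t \<Longrightarrow> B \<le> max_stat Q f w p t \<longleftrightarrow> (\<exists>k\<in>{1..t}. B \<le> ennreal (w k) * mix_stat Q f p k t)"
  unfolding max_stat_def by (subst Max_ge_iff) auto

text \<open>The terms of the sum are nonnegative, so one starting point that crosses the threshold
  suffices.\<close>

lemma tau_sum_le:
  assumes "k \<in> {1..t}" "ennreal b \<le> ennreal (w k) * mix_stat Q f (conformal_p \<omega>) k t"
  shows "tau_sum Q f w b \<omega> \<le> enat t"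
proof -
  have "ennreal (w k) * mix_stat Q f (conformal_p \<omega>) k t \<le> sum_stat Q f w (conformal_p \<omega>) t"
    unfolding sum_stat_def using assms(1) by (intro member_le_sum) auto
  then show ?thesis
    using assms unfolding tau_sum_def first_passage_le_iff by (intro bexI[of _ t]) (auto intro: order_trans)
qed

lemma tau_max_le:
  assumes "k \<in> {1..t}" "ennreal b \<le> ennreal (w k) * mix_stat Q f (conformal_p \<omega>) k t"
  shows "tau_max Q f w b \<omega> \<le> enat t"
  unfolding tau_max_def first_passage_le_iff
proof (intro bexI)
  show "ennreal b \<le> max_stat Q f w (conformal_p \<omega>) t"
    using assms by (subst max_stat_ge_iff) auto
qed (use assms in auto)

text \<open>The real number \<open>y\<close> between the two logarithms rules out the degenerate
  values: a zero weight would make the budget \<infinity>, and m = 0 would have logarithm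
  -\<infinity>. If \<open>m\<close> is infinite, the positive weight carries it over any
  threshold.\<close>

lemma threshold_le_of_log_budget_le:
  assumes b: "0 < b" and w: "0 \<le> w (T + 1)"
    and bud: "log_budget w T b \<le> ereal y" and M: "ereal y \<le> ennreal_log m"
  shows "ennreal b \<le> ennreal (w (T + 1)) * m"
proof -
  let ?w = "w (T + 1)"
  have "?w \<noteq> 0"
    using bud b by (auto simp: log_budget_def ennreal_log_def)
  then have w': "0 < ?w" using w by simp
  then have lb: "log_budget w T b = ereal (ln (b / ?w))"
    using b by (simp add: log_budget_def ennreal_log_def divide_ennreal)
  show ?thesis
  proof (cases m)
    case (real q)
    with M have q: "0 < q"
      by (cases "q = 0") (auto simp: ennreal_log_def)
    with M real bud lb have "ln (b / ?w) \<le> ln q"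
      by (auto simp: ennreal_log_def split: if_splits)
    then have "b \<le> ?w * q"
      using b w' q by (simp add: ln_le_cancel_iff divide_le_eq mult.commute)
    then show ?thesis
      using real q w by (simp add: ennreal_mult[symmetric] ennreal_leI)
  next
    case top
    then show ?thesis using w' by (simp add: ennreal_mult_top)
  qed
qed

text \<open>Reindexed to match the support condition, which numbers its points from 1 to r.\<close>

lemma mix_stat_shift: "mix_stat Q f p (T + 1) (T + r) = (\<integral>\<^sup>+\<theta>. ennreal (\<Prod>i=1..r. f \<theta> (p (T + i))) \<partial>Q)"
  unfolding mix_stat_def
  using prod.shift_bounds_cl_nat_ivl[of "\<lambda>j. f _ (p j)" 1 T r] by (simp add: add.commute)

section \<open>Measurability of the stopping events\<close>

context changepoint_row
begin

lemma conformal_p_measurable[measurable]: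
  "1 \<le> j \<Longrightarrow> (\<lambda>\<omega>. conformal_p \<omega> j) \<in> borel_measurable row"
  unfolding conformal_p_eq_rank_scores
  by (intro borel_measurable_divide borel_measurable_sum rank_score_measurable) auto

text \<open>Joint measurability of the family makes the integrand jointly measurable in the row and
  the parameter; integrating out the parameter preserves measurability.\<close>

lemma mix_stat_measurable:
  assumes fam: "mix_family Q f" and k: "1 \<le> k"
  shows "(\<lambda>\<omega>. mix_stat Q f (conformal_p \<omega>) k t) \<in> borel_measurable row"
proof -
  interpret Q: prob_space Q
    using fam by (simp add: mix_family_def)
  have f: "(\<lambda>(\<theta>, u). f \<theta> u) \<in> borel_measurable (Q \<Otimes>\<^sub>M borel)"
    using fam by (simp add: mix_family_def)
  have "(\<lambda>z. f (snd z) (conformal_p (fst z) j)) \<in> borel_measurable (row \<Otimes>\<^sub>M Q)" if "j \<in> {k..t}" for j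
  proof -
    have "(\<lambda>z. (snd z, conformal_p (fst z) j)) \<in> measurable (row \<Otimes>\<^sub>M Q) (Q \<Otimes>\<^sub>M borel)"
      using that k by (intro measurable_Pair measurable_snd measurable_compose[OF measurable_fst conformal_p_measurable]) auto
    from measurable_compose[OF this f] show ?thesis by simp
  qed
  then have "(\<lambda>(\<omega>, \<theta>). ennreal (\<Prod>j=k..t. f \<theta> (conformal_p \<omega> j))) \<in> borel_measurable (row \<Otimes>\<^sub>M Q)"
    unfolding case_prod_beta by (intro measurable_compose[OF _ measurable_ennreal] borel_measurable_prod) auto
  then show ?thesis
    unfolding mix_stat_def by (rule Q.borel_measurable_nn_integral)
qed

lemma sets_tau_sum_le:
  assumes "mix_family Q f"
  shows "{\<omega>\<in>space row. tau_sum Q f w b \<omega> \<le> enat N} \<in> sets row"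
proof -
  have S: "(\<lambda>\<omega>. sum_stat Q f w (conformal_p \<omega>) t) \<in> borel_measurable row" for t
    unfolding sum_stat_def
    by (intro borel_measurable_sum borel_measurable_times_ennreal borel_measurable_const mix_stat_measurable assms) auto
  show ?thesis
    unfolding tau_sum_def first_passage_le_iff
    by (intro sets.sets_Collect_finite_Ex borel_measurable_le borel_measurable_const S) auto
qed

lemma sets_tau_max_le:
  assumes "mix_family Q f"
  shows "{\<omega>\<in>space row. tau_max Q f w b \<omega> \<le> enat N} \<in> sets row"
proof -
  have "{\<omega>\<in>space row. tau_max Q f w b \<omega> \<le> enat N}
      = {\<omega>\<in>space row. \<exists>t\<in>{1..N}. \<exists>k\<in>{1..t}. ennreal b \<le> ennreal (w k) * mix_stat Q f (conformal_p \<omega>) k t}"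
    unfolding tau_max_def first_passage_le_iff by (auto simp: max_stat_ge_iff)
  also have "\<dots> \<in> sets row"
    by (intro sets.sets_Collect_finite_Ex borel_measurable_le borel_measurable_const
        borel_measurable_times_ennreal mix_stat_measurable assms) auto
  finally show ?thesis .
qed

end

section \<open>Detection after the changepoint\<close>

text \<open>Here \<open>L\<close> may be any Lipschitz constant of ln h. The link between
  \<open>h\<close> and the Kullback-Leibler divergence is made in the final theorem; until then the
  drift \<open>D\<close> is a free parameter of the lemmas.\<close>

locale detectable_changepoint = changepoint_row P0 P1 T
  for P0 P1 :: "real measure" and T :: nat +
  fixes Q :: "'t measure" and f :: "'t \<Rightarrow> real \<Rightarrow> real" and w :: "nat \<Rightarrow> real" and b :: real
    and h :: "real \<Rightarrow> real" and a c L :: real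
  assumes cont_F: "continuous_on UNIV (cdf P0)"
    and family: "mix_family Q f"
    and w_nonneg: "0 \<le> w (T + 1)" and b_pos: "0 < b"
    and lipschitz: "L-lipschitz_on {0..1} (\<lambda>u. ln (h u))"
    and support: "\<And>r z. 1 \<le> r \<Longrightarrow> (\<And>i. i \<in> {1..r} \<Longrightarrow> z i \<in> {0..1}) \<Longrightarrow>
        ennreal_log (\<integral>\<^sup>+\<theta>. ennreal (\<Prod>i=1..r. f \<theta> (z i)) \<partial>Q)
          \<ge> ereal ((\<Sum>i=1..r. ln (h (z i))) - a * ln (real r) - c)"
begin

text \<open>The oracle version of \<open>ln (h (conformal_p \<omega> j))\<close>, with F(X_j) in
  place of the p-value. Unlike the p-values, these scores are independent across positions.\<close>

definition score :: "real \<Rightarrow> real" where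
  "score y = ln (h (cdf P0 y))"

lemma cdf_unit: "cdf P0 y \<in> {0..1}"
  using P0.cdf_nonneg P0.cdf_bounded_prob by auto

lemma score_measurable[measurable]: "score \<in> borel_measurable borel"
proof -
  have "continuous_on UNIV score"
    unfolding score_def
    by (rule continuous_on_compose2[OF lipschitz_on_continuous_on[OF lipschitz] cont_F])
       (use cdf_unit in blast)
  then show ?thesis
    by (rule borel_measurable_continuous_onI)
qed

text \<open>The pathwise core. Replacing oracle scores by scores of p-values costs at most L (|A_j -
  F(X_j)| + r / T) at each position; the support condition turns the remaining sum into a lower
  bound on the mixture started at T + 1.\<close>

lemma detection:
  assumes u: "\<And>j. j \<in> {1..} \<Longrightarrow> snd \<omega> j \<in> {0..1}" and r: "1 \<le> r"
    and W: "real r * D - x \<le> (\<Sum>j\<in>{T<..T+r}. score (fst \<omega> j))"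
    and V: "(\<Sum>j\<in>{T<..T+r}. \<bar>reference_rank T \<omega> j - cdf P0 (fst \<omega> j)\<bar>) \<le> real r * s"
    and bud: "log_budget w T b \<le> ereal (real r * D - x
      - L * real r * (s + (2 * real r + 1) / real T) - a * ln (real r) - c)"
  shows "tau_sum Q f w b \<omega> \<le> enat (T + r)" "tau_max Q f w b \<omega> \<le> enat (T + r)"
proof -
  let ?J = "{T<..T+r}" and ?p = "conformal_p \<omega>" and ?F = "\<lambda>j. cdf P0 (fst \<omega> j)"
  have L: "0 \<le> L"
    using lipschitz by (rule lipschitz_on_nonneg)
  have p: "?p j \<in> {0..1}" if "j \<in> ?J" for j
    using that u[of j] by (intro conformal_p_bounds) auto
  have dist: "\<bar>?p j - ?F j\<bar> \<le> \<bar>reference_rank T \<omega> j - ?F j\<bar> + real r / real T" if "j \<in> ?J" for j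
    using that u[of j] T_pos conformal_p_near_reference_rank[of \<omega> j T r] by force
  have "(\<Sum>j\<in>?J. score (fst \<omega> j) - L * (\<bar>reference_rank T \<omega> j - ?F j\<bar> + real r / real T))
      \<le> (\<Sum>j\<in>?J. ln (h (?p j)))"
  proof (rule sum_mono)
    fix j assume j: "j \<in> ?J"
    have "\<bar>ln (h (?p j)) - score (fst \<omega> j)\<bar> \<le> L * \<bar>?p j - ?F j\<bar>"
      using lipschitz_onD[OF lipschitz p[OF j] cdf_unit[of "fst \<omega> j"]] by (simp add: score_def dist_real_def)
    also have "\<dots> \<le> L * (\<bar>reference_rank T \<omega> j - ?F j\<bar> + real r / real T)"
      by (rule mult_left_mono[OF dist[OF j] L])
    finally show "score (fst \<omega> j) - L * (\<bar>reference_rank T \<omega> j - ?F j\<bar> + real r / real T) \<le> ln (h (?p j))"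
      by linarith
  qed
  moreover have "(\<Sum>j\<in>?J. score (fst \<omega> j) - L * (\<bar>reference_rank T \<omega> j - ?F j\<bar> + real r / real T))
      = (\<Sum>j\<in>?J. score (fst \<omega> j)) - L * ((\<Sum>j\<in>?J. \<bar>reference_rank T \<omega> j - ?F j\<bar>) + real r * (real r / real T))"
    by (simp add: sum_subtractf sum.distrib sum_distrib_left[symmetric])
  \<comment> \<open>\<open>V\<close> bounds the first sum by r s, and r / T is relaxed to (2 r + 1)
    / T.\<close>
  moreover have "L * ((\<Sum>j\<in>?J. \<bar>reference_rank T \<omega> j - ?F j\<bar>) + real r * (real r / real T))
      \<le> L * (real r * (s + (2 * real r + 1) / real T))"
    using V by (intro mult_left_mono[OF _ L]) (auto simp: distrib_left intro!: add_mono divide_right_mono mult_left_mono)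
  ultimately have sum: "real r * D - x - L * real r * (s + (2 * real r + 1) / real T)
      \<le> (\<Sum>j\<in>?J. ln (h (?p j)))"
    using W by (simp add: mult.assoc)
  have "(\<Sum>j\<in>?J. ln (h (?p j))) = (\<Sum>i=1..r. ln (h (?p (T + i))))"
    using sum.shift_bounds_cl_nat_ivl[of "\<lambda>j. ln (h (?p j))" 1 T r]
    by (simp add: add.commute atLeastSucAtMost_greaterThanAtMost)
  with sum have "ereal (real r * D - x - L * real r * (s + (2 * real r + 1) / real T) - a * ln (real r) - c)
      \<le> ereal ((\<Sum>i=1..r. ln (h (?p (T + i)))) - a * ln (real r) - c)"
    by simp
  also have "\<dots> \<le> ennreal_log (mix_stat Q f ?p (T + 1) (T + r))"
    unfolding mix_stat_shift using p r by (intro support) auto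
  finally have "ennreal b \<le> ennreal (w (T + 1)) * mix_stat Q f ?p (T + 1) (T + r)"
    by (rule threshold_le_of_log_budget_le[OF b_pos w_nonneg bud])
  then show "tau_sum Q f w b \<omega> \<le> enat (T + r)" "tau_max Q f w b \<omega> \<le> enat (T + r)"
    using r by (auto intro!: tau_sum_le[of "T + 1"] tau_max_le[of "T + 1"])
qed

lemma sets_both_detect:
  "{\<omega>\<in>space row. tau_sum Q f w b \<omega> \<le> enat N \<and> tau_max Q f w b \<omega> \<le> enat N} \<in> sets row"
  by (intro sets.sets_Collect_conj sets_tau_sum_le sets_tau_max_le family)

text \<open>Up to a null set of randomizers, failure of either detector lies in the union of the
  score deviation \<open>?W\<close> and the rank deviation \<open>?V\<close>. The bound \<epsilon>
  on \<open>?W\<close> stays abstract so that a constant score, where the deviation x is 0, is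
  covered as well.\<close>

lemma both_detect_prob:
  assumes r: "1 \<le> r" and s: "0 < s"
    and W: "\<P>(\<omega> in row. (\<Sum>j\<in>{T<..T+r}. score (fst \<omega> j)) < real r * D - x) \<le> \<epsilon>"
    and bud: "log_budget w T b \<le> ereal (real r * D - x
      - L * real r * (s + (2 * real r + 1) / real T) - a * ln (real r) - c)"
  shows "\<P>(\<omega> in row. tau_sum Q f w b \<omega> \<le> enat (T + r) \<and> tau_max Q f w b \<omega> \<le> enat (T + r))
      \<ge> 1 - (\<epsilon> + 2 * exp (- 2 * real T * s\<^sup>2))"
proof -
  interpret row': prob_space row by (rule prob_space_row)
  let ?J = "{T<..T+r}"
  let ?both = "{\<omega>\<in>space row. tau_sum Q f w b \<omega> \<le> enat (T + r) \<and> tau_max Q f w b \<omega> \<le> enat (T + r)}"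
  let ?W = "{\<omega>\<in>space row. (\<Sum>j\<in>?J. score (fst \<omega> j)) < real r * D - x}"
  let ?V = "{\<omega>\<in>space row. real r * s \<le> (\<Sum>j\<in>?J. \<bar>reference_rank T \<omega> j - cdf P0 (fst \<omega> j)\<bar>)}"
  have F: "cdf P0 \<in> borel_measurable borel"
    by (intro borel_measurable_mono monoI P0.cdf_nondecreasing)
  have W_sets: "?W \<in> sets row"
    by (intro borel_measurable_less borel_measurable_sum borel_measurable_const
        measurable_compose[OF obs_measurable score_measurable]) auto
  have V_sets: "?V \<in> sets row"
    by (intro borel_measurable_le borel_measurable_sum borel_measurable_abs borel_measurable_diff borel_measurable_const
        reference_rank_measurable measurable_compose[OF obs_measurable F]) auto
  have "row'.prob (space row - ?both) \<le> row'.prob (?W \<union> ?V)"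
  proof (rule row'.finite_measure_mono_AE)
    show "AE \<omega> in row. \<omega> \<in> space row - ?both \<longrightarrow> \<omega> \<in> ?W \<union> ?V"
      using AE_randomizers
    proof eventually_elim
      case (elim \<omega>)
      show ?case
      proof (rule impI, rule ccontr)
        assume "\<omega> \<in> space row - ?both" and "\<omega> \<notin> ?W \<union> ?V"
        with elim detection[OF _ r _ _ bud, of \<omega>] show False by auto
      qed
    qed
  qed (use W_sets V_sets in auto)
  also have "\<dots> \<le> row'.prob ?W + row'.prob ?V"
    using W_sets V_sets by (intro measure_Un_le)
  also have "\<dots> \<le> \<epsilon> + 2 * exp (- 2 * real T * s\<^sup>2)"
    using W reference_rank_average_deviation[OF cont_F r s] by (intro add_mono)
  finally show ?thesis
    using row'.prob_compl[OF sets_both_detect, of "T + r"] by simp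
qed

end

section \<open>Explicit tail and confidence bounds\<close>

theorem propositionC1:
  fixes T :: "nat \<Rightarrow> nat" and P0 P1 :: "real measure"
    and Q :: "'t measure" and f :: "'t \<Rightarrow> real \<Rightarrow> real"
    and w b :: "nat \<Rightarrow> real" and h :: "real \<Rightarrow> real"
    and a c D L K :: real
  assumes T_pos: "\<And>n. 1 \<le> n \<Longrightarrow> 1 \<le> T n"
    and T_mono: "\<And>m n. 1 \<le> m \<Longrightarrow> m \<le> n \<Longrightarrow> T m \<le> T n"
    and T_lim: "filterlim T at_top sequentially"
    and P0: "real_distribution P0" and P1: "real_distribution P1"
    and family: "mix_family Q f"
    and w_nonneg: "\<And>k. 1 \<le> k \<Longrightarrow> 0 \<le> w k"
    and b_pos: "\<And>n. 1 \<le> n \<Longrightarrow> 0 < b n"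
    \<comment> \<open>post-change separation\<close>
    and cont_F: "continuous_on UNIV (cdf P0)"
    and cont_H: "continuous_on {0..1} (post_cdf P0 P1)"
    and H_0: "post_cdf P0 P1 0 = 0"
    and sep: "0 < (SUP t\<in>{0..1}. \<bar>post_cdf P0 P1 t - t\<bar>)"
    \<comment> \<open>local KL support\<close>
    and abs_cont: "absolutely_continuous unif (post_law P0 P1)"
    and h_density: "AE u in unif. RN_deriv unif (post_law P0 P1) u = ennreal (h u)"
    and D_def: "D = KL_divergence (exp 1) unif (post_law P0 P1)"
    and D_finite: "integrable (post_law P0 P1) (entropy_density (exp 1) unif (post_law P0 P1))"
    and D_pos: "0 < D"
    and h_pos: "\<And>u. u \<in> {0..1} \<Longrightarrow> 0 < h u"
    and phi_bounded: "bounded ((\<lambda>u. ln (h u)) ` {0..1})"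
    and phi_lipschitz: "\<exists>C. C-lipschitz_on {0..1} (\<lambda>u. ln (h u))"
    and a_nonneg: "0 \<le> a" and c_nonneg: "0 \<le> c"
    and support: "\<And>r z. 1 \<le> r \<Longrightarrow> (\<And>i. i \<in> {1..r} \<Longrightarrow> z i \<in> {0..1}) \<Longrightarrow>
        ennreal_log (\<integral>\<^sup>+\<theta>. ennreal (\<Prod>i=1..r. f \<theta> (z i)) \<partial>Q)
          \<ge> ereal ((\<Sum>i=1..r. ln (h (z i))) - a * ln (real r) - c)"
    \<comment> \<open>threshold scaling\<close>
    and budget_lim: "(\<lambda>n. log_budget w (T n) (b n)) \<longlonglongrightarrow> \<infinity>"
    and budget_small: "(\<lambda>n. log_budget w (T n) (b n) / ereal (real (T n))) \<longlonglongrightarrow> 0"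
    and L_def: "L = lipschitz_const {0..1} (\<lambda>u. ln (h u))"
    and K_def: "K = oscillation {0..1} (\<lambda>u. ln (h u))"
  shows "\<forall>n\<ge>1.
    (\<forall>s>0. \<forall>x>0. \<forall>r\<ge>1::nat.
       ereal (real r * D - x - L * real r * (s + (2 * real r + 1) / real (T n)) - a * ln (real r) - c)
         \<ge> log_budget w (T n) (b n) \<longrightarrow>
       \<P>(\<omega> in row_law P0 (T n) P1. tau_sum Q f w (b n) \<omega> > enat (T n + r))
         \<le> exp (- (2 * x\<^sup>2 / (real r * K\<^sup>2))) + 2 * exp (- 2 * real (T n) * s\<^sup>2) \<and>
       \<P>(\<omega> in row_law P0 (T n) P1. tau_max Q f w (b n) \<omega> > enat (T n + r))
         \<le> exp (- (2 * x\<^sup>2 / (real r * K\<^sup>2))) + 2 * exp (- 2 * real (T n) * s\<^sup>2)) \<and>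
    (\<forall>\<delta>. 0 < \<delta> \<and> \<delta> < 1 \<longrightarrow> (\<forall>r\<ge>1::nat.
       ereal (real r * D - a * ln (real r) - c - K * sqrt (real r * ln (2 / \<delta>) / 2)
              - L * real r * (sqrt (ln (4 / \<delta>) / (2 * real (T n))) + (2 * real r + 1) / real (T n)))
         \<ge> log_budget w (T n) (b n) \<longrightarrow>
       \<P>(\<omega> in row_law P0 (T n) P1. tau_sum Q f w (b n) \<omega> \<le> enat (T n + r)
            \<and> tau_max Q f w (b n) \<omega> \<le> enat (T n + r)) \<ge> 1 - \<delta>))"
proof (intro allI impI)
  fix n :: nat assume n: "1 \<le> n"
  interpret P0: real_distribution P0 by (rule P0)
  interpret P1: real_distribution P1 by (rule P1)
  let ?\<phi> = "\<lambda>u. ln (h u)"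
  have lip: "L-lipschitz_on {0..1} ?\<phi>"
    using phi_lipschitz lipschitz_on_lipschitz_const unfolding L_def by blast
  interpret detectable_changepoint P0 P1 "T n" Q f w "b n" h a c L
    using T_pos[OF n] cont_F family w_nonneg b_pos[OF n] lip support by unfold_locales auto
  interpret row': prob_space row by (rule prob_space_row)

  define \<alpha> \<beta> where "\<alpha> = (INF u\<in>{0..1}. ?\<phi> u)" and "\<beta> = (SUP u\<in>{0..1}. ?\<phi> u)"
  have K: "K = \<beta> - \<alpha>"
    by (simp add: K_def oscillation_def \<alpha>_def \<beta>_def)
  have score_bounds: "score y \<in> {\<alpha>..\<beta>}" for y
    using phi_bounded cdf_unit[of y] unfolding score_def \<alpha>_def \<beta>_def
    by (auto intro!: cINF_lower cSUP_upper bounded_imp_bdd_below bounded_imp_bdd_above)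
  from this[of 0] have K_nonneg: "0 \<le> K"
    unfolding K by simp
  \<comment> \<open>The entropy density equals ln h almost everywhere under \<open>unif\<close>,
    hence by absolute continuity under H; the base exp 1 gives the natural logarithm. As H is the
    image of \<open>P1\<close> under \<open>cdf P0\<close>, the divergence becomes the mean
    score.\<close>
  have D: "D = P1.expectation score"
  proof -
    have F[measurable]: "cdf P0 \<in> borel_measurable borel"
      by (intro borel_measurable_mono monoI P0.cdf_nondecreasing)
    let ?H = "post_law P0 P1" and ?e = "entropy_density (exp 1) unif (post_law P0 P1)"
    have sets_H: "sets ?H = sets unif"
      by (simp add: post_law_def)
    have "AE u in unif. ?e u = ln (h u)"
      using h_density AE_unif
    proof eventually_elim
      case (elim u)
      then show ?case
        using h_pos[of u] by (simp add: entropy_density_def log_def)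
    qed
    then have "AE u in ?H. ?e u = ln (h u)"
      by (rule absolutely_continuous_AE[OF sets_H abs_cont])
    then have "AE y in P1. ?e (cdf P0 y) = score y"
      unfolding post_law_def score_def by (rule AE_distrD[rotated]) simp
    moreover have e: "?e \<in> borel_measurable borel"
      using measurable_entropy_density[of "exp 1" unif ?H] by (simp cong: measurable_cong_sets)
    ultimately have "P1.expectation (\<lambda>y. ?e (cdf P0 y)) = P1.expectation score"
      by (intro integral_cong_AE measurable_compose[OF _ e]) auto
    moreover have "D = P1.expectation (\<lambda>y. ?e (cdf P0 y))"
      unfolding D_def KL_divergence_def
      by (subst (1) post_law_def, rule integral_distr) (simp_all add: e)
    ultimately show ?thesis by simp
  qed

  let ?W = "\<lambda>r x. {\<omega>\<in>space row. (\<Sum>j\<in>{T n<..T n + r}. score (fst \<omega> j)) < real r * D - x}"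
  have W: "row'.prob (?W r x) \<le> exp (- (2 * x\<^sup>2 / (real r * K\<^sup>2)))" if r: "1 \<le> r" and x: "0 < x" for r x
  \<comment> \<open>For K = 0 division by zero turns the right side into exp 0 = 1, the trivial
    bound.\<close>
  proof (cases "K = 0")
    case False
    have "row'.prob (?W r x) \<le> row'.prob {\<omega>\<in>space row. (\<Sum>j\<in>{T n<..T n + r}. score (fst \<omega> j)) \<le> real r * D - x}"
      by (intro row'.finite_measure_mono borel_measurable_le borel_measurable_sum borel_measurable_const
          measurable_compose[OF obs_measurable score_measurable]) auto
    also have "\<dots> \<le> exp (- (2 * x\<^sup>2 / (real r * K\<^sup>2)))"
      unfolding D K using False K_nonneg
      by (intro post_change_sum_lower_tail score_measurable score_bounds r x) (auto simp: K)
    finally show ?thesis .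
  qed simp
  \<comment> \<open>In the confidence bound K = 0 forces x = 0, outside the range of
    \<open>W\<close>. A constant score then sums to exactly r D, so the strict inequality fails
    everywhere.\<close>
  have W_0: "?W r 0 = {}" if "K = 0" for r
  proof -
    have "score y = \<alpha>" for y
      using score_bounds[of y] that by (simp add: K)
    then have "score = (\<lambda>_. \<alpha>)" ..
    then show ?thesis
      using P1.prob_space by (simp add: D)
  qed

  show "(\<forall>s>0. \<forall>x>0. \<forall>r\<ge>1::nat.
       ereal (real r * D - x - L * real r * (s + (2 * real r + 1) / real (T n)) - a * ln (real r) - c)
         \<ge> log_budget w (T n) (b n) \<longrightarrow>
       \<P>(\<omega> in row_law P0 (T n) P1. tau_sum Q f w (b n) \<omega> > enat (T n + r))
         \<le> exp (- (2 * x\<^sup>2 / (real r * K\<^sup>2))) + 2 * exp (- 2 * real (T n) * s\<^sup>2) \<and>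
       \<P>(\<omega> in row_law P0 (T n) P1. tau_max Q f w (b n) \<omega> > enat (T n + r))
         \<le> exp (- (2 * x\<^sup>2 / (real r * K\<^sup>2))) + 2 * exp (- 2 * real (T n) * s\<^sup>2)) \<and>
    (\<forall>\<delta>. 0 < \<delta> \<and> \<delta> < 1 \<longrightarrow> (\<forall>r\<ge>1::nat.
       ereal (real r * D - a * ln (real r) - c - K * sqrt (real r * ln (2 / \<delta>) / 2)
              - L * real r * (sqrt (ln (4 / \<delta>) / (2 * real (T n))) + (2 * real r + 1) / real (T n)))
         \<ge> log_budget w (T n) (b n) \<longrightarrow>
       \<P>(\<omega> in row_law P0 (T n) P1. tau_sum Q f w (b n) \<omega> \<le> enat (T n + r)
            \<and> tau_max Q f w (b n) \<omega> \<le> enat (T n + r)) \<ge> 1 - \<delta>))"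
    (is "?tails \<and> ?confidence")
  proof
    show ?tails
    proof (intro allI impI)
      fix s x :: real and r :: nat
      assume s: "0 < s" and x: "0 < x" and r: "1 \<le> r"
        and bud: "log_budget w (T n) (b n) \<le> ereal (real r * D - x
          - L * real r * (s + (2 * real r + 1) / real (T n)) - a * ln (real r) - c)"
      let ?both = "{\<omega>\<in>space row. tau_sum Q f w (b n) \<omega> \<le> enat (T n + r) \<and> tau_max Q f w (b n) \<omega> \<le> enat (T n + r)}"
      have "row'.prob (space row - ?both) \<le> exp (- (2 * x\<^sup>2 / (real r * K\<^sup>2))) + 2 * exp (- 2 * real (T n) * s\<^sup>2)"
        using both_detect_prob[OF r s W[OF r x] bud] row'.prob_compl[OF sets_both_detect, of "T n + r"] by simp
      \<comment> \<open>Lateness of either stopping time already leaves the joint event, so both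
        tails inherit one bound.\<close>
      moreover have "row'.prob {\<omega>\<in>space row. tau_sum Q f w (b n) \<omega> > enat (T n + r)} \<le> row'.prob (space row - ?both)"
        "row'.prob {\<omega>\<in>space row. tau_max Q f w (b n) \<omega> > enat (T n + r)} \<le> row'.prob (space row - ?both)"
        using sets_both_detect by (intro row'.finite_measure_mono; auto)+
      ultimately show "row'.prob {\<omega>\<in>space row. tau_sum Q f w (b n) \<omega> > enat (T n + r)}
            \<le> exp (- (2 * x\<^sup>2 / (real r * K\<^sup>2))) + 2 * exp (- 2 * real (T n) * s\<^sup>2) \<and>
          row'.prob {\<omega>\<in>space row. tau_max Q f w (b n) \<omega> > enat (T n + r)}
            \<le> exp (- (2 * x\<^sup>2 / (real r * K\<^sup>2))) + 2 * exp (- 2 * real (T n) * s\<^sup>2)"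
        by linarith
    qed
    show ?confidence
    proof (intro allI impI)
      fix \<delta> :: real and r :: nat
      assume \<delta>: "0 < \<delta> \<and> \<delta> < 1" and r: "1 \<le> r"
        and bud: "log_budget w (T n) (b n)
          \<le> ereal (real r * D - a * ln (real r) - c - K * sqrt (real r * ln (2 / \<delta>) / 2)
              - L * real r * (sqrt (ln (4 / \<delta>) / (2 * real (T n))) + (2 * real r + 1) / real (T n)))"
      \<comment> \<open>The error \<delta> is split evenly: for K > 0, \<open>x\<close> solves exp
        (- 2 x^2 / (r K^2)) = \<delta> / 2, and \<open>s\<close> solves 2 exp (- 2 T s^2) = \<delta>
        / 2.\<close>
      define x where "x = K * sqrt (real r * ln (2 / \<delta>) / 2)"
      define s where "s = sqrt (ln (4 / \<delta>) / (2 * real (T n)))"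
      have logs: "0 < ln (2 / \<delta>)" "0 < ln (4 / \<delta>)"
        using \<delta> by (simp_all add: less_divide_eq)
      have Tn: "0 < real (T n)"
        using T_pos by simp
      have s: "0 < s"
        using logs Tn by (simp add: s_def)
      have "real (T n) * s\<^sup>2 = ln (4 / \<delta>) / 2"
        using logs Tn by (simp add: s_def)
      then have "2 * exp (- 2 * real (T n) * s\<^sup>2) = 2 * exp (- ln (4 / \<delta>))"
        by simp
      also have "\<dots> = \<delta> / 2"
        using \<delta> by (simp add: exp_minus)
      finally have tail_s: "2 * exp (- 2 * real (T n) * s\<^sup>2) = \<delta> / 2" .
      have tail_x: "row'.prob (?W r x) \<le> \<delta> / 2"
      proof (cases "K = 0")
        case True
        then have empty: "?W r x = {}"
          using W_0 by (simp add: x_def)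
        show ?thesis
          unfolding empty using \<delta> by simp
      next
        case False
        then have "0 < x" and sq: "2 * x\<^sup>2 / (real r * K\<^sup>2) = ln (2 / \<delta>)"
          using K_nonneg logs r by (simp_all add: x_def power_mult_distrib)
        have "row'.prob (?W r x) \<le> exp (- ln (2 / \<delta>))"
          using W[OF r \<open>0 < x\<close>] unfolding sq .
        also have "\<dots> = \<delta> / 2"
          using \<delta> by (simp add: exp_minus)
        finally show ?thesis .
      qed
      have "log_budget w (T n) (b n) \<le> ereal (real r * D - x
          - L * real r * (s + (2 * real r + 1) / real (T n)) - a * ln (real r) - c)"
        using bud by (simp add: x_def s_def algebra_simps)
      from both_detect_prob[OF r s tail_x this]
      show "row'.prob {\<omega>\<in>space row. tau_sum Q f w (b n) \<omega> \<le> enat (T n + r)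
            \<and> tau_max Q f w (b n) \<omega> \<le> enat (T n + r)} \<ge> 1 - \<delta>"
        unfolding tail_s by simp
    qed
  qed
qed

end
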